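(* Suppose that $X=(X,d_X)$ and $Y=(Y,d_Y)$ are non-degenerate bounded metric spaces, and let $\mathrm{P}$ denote either one of $\mathrm{Pc}$, $\mathrm{Pp}$ (the same choice for $X$ and $Y$). The following are equivalent: (1) $X$ and $Y$ are bi-lipschitz homeomorphic; (2) there exists an isometry $T:\mathrm{LPM}(X,d_X)\to \mathrm{LPM}(Y,d_Y)$ with $T(\mathrm{P}(X)\cap \mathrm{LPM}(X,d_X))=\mathrm{P}(Y)\cap \mathrm{LPM}(Y,d_Y)$. In this case, for each isometry $T:\mathrm{LPM}(X,d_X)\to \mathrm{LPM}(Y,d_Y)$ with $T(\mathrm{P}(X)\cap \mathrm{LPM}(X,d_X))=\mathrm{P}(Y)\cap \mathrm{LPM}(Y,d_Y)$, there exists a bi-lipschitz homeomorphism $\phi:Y\to X$ such that for all $d\in \mathrm{LPM}(X,d_X)$ and for all $x,y\in Y$, $$T(d)(x,y)=d(\phi(x),\phi(y)).$$ Except for the case that the cardinality of $X$ or $Y$ is equal to $2$, the map $\phi$ can be chosen uniquely.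
   Context: Non-degenerate means having at least two points. "Isometry" always means surjective isometry. For a metric space $Z=(Z,d_Z)$, $\mathrm{PM}(Z)$ is the set of bounded continuous pseudometrics on $Z$, viewed as functions on $Z^2$, with the sup-norm $\|\cdot\|$; all sets of pseudometrics below carry the metric induced by $\|\cdot\|$. $\mathrm{Pc}(Z)$ is the set of $d\in\mathrm{PM}(Z)$ for which there are a doubleton $\{z,w\}\subset Z$ and a compact subset $K\subset Z$ such that $d(z,w)=\|d\|$ and, whenever $d(x,y)=\|d\|$, then $x,y\in K$. $\mathrm{Pp}(Z)$ is the set of $d\in\mathrm{PM}(Z)$ for which there is exactly one (unordered) $\{z,w\}\subset Z$ with $d(z,w)=\|d\|$. A pseudometric $d$ on $Z$ is lipschitz continuous with respect to $d_Z$ if there is $k>0$ with $d(x,y)\le k\,d_Z(x,y)$ for all $x\ne y$ in $Z$. $\mathrm{LPM}(Z,d_Z)$ is the set of bounded lipschitz continuous pseudometrics on $Z$ with respect to $d_Z$. A bijection $\phi:Y\to X$ is bi-lipschitz if there is $\lambda\ge 1$ with $\frac1\lambda d_Y(x,y)\le d_X(\phi(x),\phi(y))\le\lambda d_Y(x,y)$ for all $x,y\in Y$; $X$ and $Y$ are bi-lipschitz homeomorphic if such a $\phi$ exists. *)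

theory Defs
  imports "HOL-Analysis.Analysis"
begin

definition pseudometric :: "('a \<Rightarrow> 'a \<Rightarrow> real) \<Rightarrow> bool" where
  "pseudometric p \<longleftrightarrow>
     (\<forall>x y. 0 \<le> p x y) \<and> (\<forall>x. p x x = 0) \<and> (\<forall>x y. p x y = p y x) \<and>
     (\<forall>x y z. p x z \<le> p x y + p y z)"

text \<open>Elements of the sets below have the library type of bounded continuous real functions
  on the square of the space, so that \<open>norm\<close> and \<open>dist\<close> are the sup-norm and its metric.\<close>

definition PM :: "(('a::metric_space \<times> 'a) \<Rightarrow>\<^sub>C real) set" where
  "PM = {d. pseudometric (\<lambda>x y. apply_bcontfun d (x, y))}"

definition Pc :: "(('a::metric_space \<times> 'a) \<Rightarrow>\<^sub>C real) set" where
  "Pc = {d \<in> PM. \<exists>z w K. z \<noteq> w \<and> apply_bcontfun d (z, w) = norm d \<and> compact K \<and>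
           (\<forall>x y. apply_bcontfun d (x, y) = norm d \<longrightarrow> x \<in> K \<and> y \<in> K)}"

text \<open>The unordered pair is not required to be a doubleton. Hence the zero pseudometric is not in
  \<open>Pp\<close> as soon as there are two points; for nonzero \<open>d\<close> the pair is automatically a doubleton.\<close>

definition Pp :: "(('a::metric_space \<times> 'a) \<Rightarrow>\<^sub>C real) set" where
  "Pp = {d \<in> PM. \<exists>!A. \<exists>z w. A = {z, w} \<and> apply_bcontfun d (z, w) = norm d}"

definition lipschitz_pseudometric :: "('a::metric_space \<Rightarrow> 'a \<Rightarrow> real) \<Rightarrow> bool" where
  "lipschitz_pseudometric p \<longleftrightarrow>
     pseudometric p \<and> (\<exists>k>0. \<forall>x y. x \<noteq> y \<longrightarrow> p x y \<le> k * dist x y)"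

definition LPM :: "(('a::metric_space \<times> 'a) \<Rightarrow>\<^sub>C real) set" where
  "LPM = {d. lipschitz_pseudometric (\<lambda>x y. apply_bcontfun d (x, y))}"

text \<open>A lipschitz pseudometric is automatically continuous on the square, so the type of \<open>LPM\<close>
  does not exclude any bounded lipschitz pseudometric.\<close>

lemma bounded_lipschitz_pseudometric_in_LPM:
  fixes p :: "'a::metric_space \<Rightarrow> 'a \<Rightarrow> real"
  assumes lip: "lipschitz_pseudometric p" and bdd: "bounded (range (\<lambda>(x, y). p x y))"
  shows "\<exists>d\<in>LPM. \<forall>x y. apply_bcontfun d (x, y) = p x y"
proof -
  from lip obtain k where p: "pseudometric p" and "k > 0"
    and k': "\<And>x y. x \<noteq> y \<Longrightarrow> p x y \<le> k * dist x y"
    unfolding lipschitz_pseudometric_def by blast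
  have k: "p x y \<le> k * dist x y" for x y
    using k'[of x y] p by (cases "x = y") (auto simp: pseudometric_def)
  have tri: "\<bar>p x y - p x' y'\<bar> \<le> p x x' + p y y'" for x y x' y'
    using p unfolding pseudometric_def by (smt (verit))
  have "(2 * k)-lipschitz_on UNIV (\<lambda>(x, y). p x y)"
  proof (rule lipschitz_onI)
    show "dist ((\<lambda>(x, y). p x y) u) ((\<lambda>(x, y). p x y) v) \<le> 2 * k * dist u v" for u v
    proof -
      have "k * dist (fst u) (fst v) \<le> k * dist u v" "k * dist (snd u) (snd v) \<le> k * dist u v"
        using \<open>k > 0\<close> dist_fst_le[of u v] dist_snd_le[of u v] by simp_all
      then show ?thesis
        using tri[of "fst u" "snd u" "fst v" "snd v"] k[of "fst u" "fst v"] k[of "snd u" "snd v"]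
        by (simp add: dist_real_def case_prod_beta)
    qed
  qed (use \<open>k > 0\<close> in simp)
  then have "continuous_on UNIV (\<lambda>(x, y). p x y)"
    by (rule lipschitz_on_continuous_on)
  then obtain d where d: "(\<lambda>(x, y). p x y) = apply_bcontfun d"
    using bdd bcontfunE[of "\<lambda>(x, y). p x y"] by (auto simp: bcontfun_def)
  have "apply_bcontfun d (x, y) = p x y" for x y
    using fun_cong[OF d, of "(x, y)"] by simp
  then show ?thesis
    using lip by (intro bexI[of _ d]) (simp_all add: LPM_def)
qed

definition isometry_onto ::
    "('c::metric_space \<Rightarrow> 'd::metric_space) \<Rightarrow> 'c set \<Rightarrow> 'd set \<Rightarrow> bool" where
  "isometry_onto T A B \<longleftrightarrow> T ` A = B \<and> (\<forall>d\<in>A. \<forall>e\<in>A. dist (T d) (T e) = dist d e)"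

definition bi_lipschitz :: "('b::metric_space \<Rightarrow> 'a::metric_space) \<Rightarrow> bool" where
  "bi_lipschitz \<phi> \<longleftrightarrow> bij \<phi> \<and>
     (\<exists>l\<ge>1. \<forall>x y. (1 / l) * dist x y \<le> dist (\<phi> x) (\<phi> y) \<and> dist (\<phi> x) (\<phi> y) \<le> l * dist x y)"

end

theory Submission
  imports Defs
begin

text \<open>An isometry \<open>T\<close> fixes the origin of the cone \<open>LPM\<close>, hence preserves norms. For \<open>z \<noteq> w\<close>, the functions in \<open>P\<close> that
  attain their norm at \<open>(z, w)\<close> have images whose peak sets are compact and have the finite
  intersection property, so these images share a peak \<open>(u, v)\<close>. Adding to any \<open>d\<close> a sufficiently steep
  \<open>p\<close> peaking exactly at \<open>{z, w}\<close> makes \<open>d + p\<close> peak exactly there, and comparing \<open>T (d + p)\<close> with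
  \<open>T d\<close> gives \<open>d (z, w) \<le> T d (u, v)\<close>; the inverse of \<open>T\<close> gives equality. So \<open>T\<close> is a
  composition with a bijection of doubletons. Testing the triangle inequality on cut pseudometrics
  shows that this bijection maps triangles to triangles and stars to stars, so it is induced by a
  bijection of points, which is bi-lipschitz since \<open>T\<close> and its inverse map the metrics into \<open>LPM\<close>.\<close>

section \<open>Lipschitz pseudometrics with prescribed peaks and cuts\<close>

lemma LPM_iff:
  "d \<in> LPM \<longleftrightarrow> pseudometric (\<lambda>x y. d (x, y)) \<and> (\<exists>k>0. \<forall>x y. d (x, y) \<le> k * dist x y)"
  unfolding LPM_def lipschitz_pseudometric_def pseudometric_def by (simp, metis dist_self mult_zero_right order_refl)

lemma LPM_subset_PM: "LPM \<subseteq> PM"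
  by (auto simp: LPM_iff PM_def)

section \<open>Pointwise rules and closure under sums and scaling\<close>

lemma PM_nonneg: "d \<in> PM \<Longrightarrow> 0 \<le> d u"
  by (cases u) (simp add: PM_def pseudometric_def)

lemma PM_self: "d \<in> PM \<Longrightarrow> d (x, x) = 0"
  by (simp add: PM_def pseudometric_def)

lemma PM_sym: "d \<in> PM \<Longrightarrow> d (x, y) = d (y, x)"
  by (simp add: PM_def pseudometric_def)

lemma PM_triangle: "d \<in> PM \<Longrightarrow> d (x, z) \<le> d (x, y) + d (y, z)"
  by (simp add: PM_def pseudometric_def)

lemma PM_doubleton_cong: "d \<in> PM \<Longrightarrow> {x, y} = {z, w} \<Longrightarrow> d (x, y) = d (z, w)"
  by (auto simp: doubleton_eq_iff PM_sym)

lemma PM_add: "d \<in> PM \<Longrightarrow> e \<in> PM \<Longrightarrow> d + e \<in> PM"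
  unfolding PM_def pseudometric_def by (simp, smt (verit))

lemma zero_LPM: "0 \<in> LPM"
  by (auto simp: LPM_iff pseudometric_def intro!: exI[of _ 1])

lemma LPM_add:
  assumes "d \<in> LPM" "e \<in> LPM"
  shows "d + e \<in> LPM"
proof -
  obtain k l where kl: "k > 0" "l > 0" "\<And>x y. d (x, y) \<le> k * dist x y" "\<And>x y. e (x, y) \<le> l * dist x y"
    using assms unfolding LPM_iff by metis
  have "(d + e) (x, y) \<le> (k + l) * dist x y" for x y
    using kl(3,4)[of x y] by (simp add: distrib_right)
  moreover have "d + e \<in> PM"
    using assms LPM_subset_PM PM_add by blast
  ultimately show ?thesis
    using kl by (auto simp: LPM_iff PM_def intro!: exI[of _ "k + l"])
qed

lemma LPM_scaleR:
  assumes "d \<in> LPM" "0 \<le> c"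
  shows "c *\<^sub>R d \<in> LPM"
proof -
  obtain k where k: "k > 0" "\<And>x y. d (x, y) \<le> k * dist x y"
    using assms unfolding LPM_iff by metis
  \<comment> \<open>The summand 1 keeps the constant positive when \<open>c = 0\<close>.\<close>
  have "(c *\<^sub>R d) (x, y) \<le> (c * k + 1) * dist x y" for x y
    using mult_left_mono[OF k(2)[of x y] assms(2)] by (simp add: algebra_simps add_increasing)
  moreover have "pseudometric (\<lambda>x y. (c *\<^sub>R d) (x, y))"
    using assms by (auto simp: LPM_iff pseudometric_def mult_left_mono simp flip: distrib_left)
  ultimately show ?thesis
    using assms k by (auto simp: LPM_iff add_nonneg_pos intro!: exI[of _ "c * k + 1"])
qed

section \<open>Sup-norm estimates\<close>

lemma apply_bcontfun_le_norm: "d u \<le> norm d" for d :: "'a::topological_space \<Rightarrow>\<^sub>C real"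
  using norm_bounded[of d u] by simp

lemma norm_eq_max:
  assumes "d \<in> PM" "\<And>x y. d (x, y) \<le> d (z, w)"
  shows "norm d = d (z, w)"
proof (rule antisym)
  show "norm d \<le> d (z, w)"
    using assms PM_nonneg[OF assms(1)] by (intro norm_bound) auto
qed (rule apply_bcontfun_le_norm)

text \<open>At a peak \<open>u\<close> of \<open>d\<close> this reads
  \<open>norm d - dist d e \<le> e u\<close>: distances, which isometries preserve, then bound
  values.\<close>

lemma apply_le_dist_add: "d u \<le> dist d e + e u" for d :: "'a::topological_space \<Rightarrow>\<^sub>C real"
  using dist_bounded[of d u e] by (simp add: dist_real_def)

text \<open>The triangle inequality is automatic for \<open>\<bar>g x - g y\<bar>\<close>, so
  constructing cuts and peaks reduces to choosing \<open>g\<close>.\<close>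

lemma LPM_of_function:
  fixes g :: "'a::metric_space \<Rightarrow> real"
  assumes lip: "\<And>x y. \<bar>g x - g y\<bar> \<le> k * dist x y" and bdd: "\<And>x. \<bar>g x\<bar> \<le> b"
  shows "\<exists>d\<in>LPM. \<forall>x y. d (x, y) = \<bar>g x - g y\<bar>"
proof -
  have "\<bar>g x - g y\<bar> \<le> (\<bar>k\<bar> + 1) * dist x y" for x y
  proof -
    have "k * dist x y \<le> (\<bar>k\<bar> + 1) * dist x y"
      by (intro mult_right_mono) auto
    then show ?thesis
      using lip[of x y] by linarith
  qed
  then have "lipschitz_pseudometric (\<lambda>x y. \<bar>g x - g y\<bar>)"
    unfolding lipschitz_pseudometric_def pseudometric_def by (auto intro!: exI[of _ "\<bar>k\<bar> + 1"])
  moreover have "\<bar>g x - g y\<bar> \<le> 2 * b" for x y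
    using bdd[of x] bdd[of y] by linarith
  then have "bounded (range (\<lambda>(x, y). \<bar>g x - g y\<bar>))"
    by (auto simp: bounded_iff intro!: exI[of _ "2 * b"])
  ultimately show ?thesis
    using bounded_lipschitz_pseudometric_in_LPM[of "\<lambda>x y. \<bar>g x - g y\<bar>"] by simp
qed

text \<open>\<open>g\<close> is the distance to \<open>A\<close>, truncated at a level that all
  points of \<open>B\<close> reach, hence constant on each of the two sets.\<close>

lemma LPM_cut:
  fixes A B :: "'a::metric_space set"
  assumes "finite A" "A \<noteq> {}" "finite B" "A \<inter> B = {}"
  obtains d r where "d \<in> LPM" "r > 0" "\<And>a b. a \<in> A \<Longrightarrow> b \<in> B \<Longrightarrow> d (a, b) = r"
    "\<And>a a'. a \<in> A \<Longrightarrow> a' \<in> A \<Longrightarrow> d (a, a') = 0" "\<And>b b'. b \<in> B \<Longrightarrow> b' \<in> B \<Longrightarrow> d (b, b') = 0"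
proof -
  \<comment> \<open>The entry 1 keeps the minimum meaningful and positive when \<open>B\<close> is
    empty.\<close>
  define r where "r = Min (insert 1 ((\<lambda>b. infdist b A) ` B))"
  define g where "g x = min r (infdist x A)" for x
  have pos: "infdist b A > 0" if "b \<in> B" for b
    using assms that by (intro infdist_pos_not_in_closed finite_imp_closed) auto
  have "r > 0"
    using assms pos by (auto simp: r_def)
  have gA: "g a = 0" if "a \<in> A" for a
    using that \<open>r > 0\<close> by (simp add: g_def)
  have gB: "g b = r" if "b \<in> B" for b
    using that assms by (auto simp: g_def r_def intro!: min_absorb1)
  have g_lip: "\<bar>g x - g y\<bar> \<le> 1 * dist x y" for x y
    using infdist_triangle_abs[of x A y] by (auto simp: g_def)
  have g_bdd: "\<bar>g x\<bar> \<le> r" for x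
    using \<open>r > 0\<close> by (auto simp: g_def infdist_nonneg)
  obtain d where "d \<in> LPM" "\<And>x y. d (x, y) = \<bar>g x - g y\<bar>"
    using LPM_of_function[of g, OF g_lip g_bdd] by blast
  then show ?thesis
    using \<open>r > 0\<close> gA gB by (intro that[of d r]) auto
qed

text \<open>\<open>p\<close> comes from a function with a cone pointing up at \<open>z\<close> and
  one pointing down at \<open>w\<close>. The cones are steeper than \<open>d\<close>, so moving away
  from \<open>z\<close> or \<open>w\<close> loses more in \<open>p\<close> than \<open>d\<close> can
  gain.\<close>

lemma LPM_add_peak:
  fixes d :: "('a::metric_space \<times> 'a) \<Rightarrow>\<^sub>C real"
  assumes bdd: "bounded (UNIV :: 'a set)" and d: "d \<in> LPM" and "z \<noteq> w"
  obtains p where "p \<in> LPM" "norm p = p (z, w)" "norm (d + p) = (d + p) (z, w)"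
    "\<And>x y. (d + p) (x, y) = norm (d + p) \<Longrightarrow> {x, y} = {z, w}"
proof -
  obtain k where k: "k > 0" "\<And>x y. d (x, y) \<le> k * dist x y"
    using d unfolding LPM_iff by metis
  obtain D where "\<And>x y :: 'a. dist x y \<le> D"
    using bdd unfolding bounded_two_points by auto
  then have D: "dist x y \<le> \<bar>D\<bar>" for x y :: 'a
    by (meson abs_ge_self order_trans)
  define r where "r = dist z w / 2"
  have "r > 0"
    using \<open>z \<noteq> w\<close> by (simp add: r_def)
  \<comment> \<open>\<open>k < n\<close> serves the points inside a cone;
    \<open>k * \<bar>D\<bar> < n * r\<close> serves those outside, where \<open>h\<close> vanishes
    and \<open>d\<close> may gain up to \<open>k * \<bar>D\<bar>\<close>.\<close>
  define n where "n = k + 1 + k * \<bar>D\<bar> / r"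
  have n: "k < n" "k * \<bar>D\<bar> < n * r" "n > 0"
    using k \<open>r > 0\<close> by (auto simp: n_def field_simps add_pos_nonneg intro!: add_pos_nonneg)
  define h where "h v x = max 0 (r - dist x v)" for v x :: 'a
  have h: "0 \<le> h v x" "h v x \<le> r" "h v x = r \<Longrightarrow> x = v" for v x
    using \<open>r > 0\<close> by (auto simp: h_def max_def split: if_splits)
  have nh: "n * h v x + k * dist x v \<le> n * r" "n * h v x + k * dist x v = n * r \<Longrightarrow> x = v" for v x
  proof -
    have "n * h v x + k * dist x v < n * r" if "x \<noteq> v"
    proof (cases "dist x v < r")
      case True
      have "k * dist x v < n * dist x v"
        using that n by simp
      then show ?thesis
        using True by (simp add: h_def algebra_simps)
    next
      case False
      have "k * dist x v \<le> k * \<bar>D\<bar>"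
        using D k by (intro mult_left_mono) auto
      then show ?thesis
        using False n by (simp add: h_def)
    qed
    then show "n * h v x + k * dist x v \<le> n * r" "n * h v x + k * dist x v = n * r \<Longrightarrow> x = v"
      using \<open>r > 0\<close> by (cases "x = v"; force simp: h_def)+
  qed
  have hd: "\<bar>h v x - h v y\<bar> \<le> dist x y" for v x y
    using dist_triangle[of x v y] dist_triangle[of y v x] by (auto simp: h_def dist_commute)
  define g where "g x = n * (h z x - h w x)" for x
  have g_diff: "\<bar>g x - g y\<bar> = n * \<bar>h z x - h w x - (h z y - h w y)\<bar>" for x y
    using n by (simp add: g_def abs_mult flip: right_diff_distrib)
  have g_lip: "\<bar>g x - g y\<bar> \<le> (n * 2) * dist x y" for x y
    unfolding g_diff mult.assoc using n hd[of z x y] hd[of w x y] by (intro mult_left_mono) auto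
  have g_bdd: "\<bar>g x\<bar> \<le> n * r" for x
    unfolding g_def abs_mult using n h(1,2)[of z x] h(1,2)[of w x] by (auto intro!: mult_mono)
  obtain p where p: "p \<in> LPM" "\<And>x y. p (x, y) = \<bar>g x - g y\<bar>"
    using LPM_of_function[of g, OF g_lip g_bdd] by blast
  have PM: "d \<in> PM" "p \<in> PM" "d + p \<in> PM"
    using d p PM_add LPM_subset_PM by blast+
  have hzw: "h z z = r" "h w w = r" "h z w = 0" "h w z = 0"
    using \<open>r > 0\<close> by (auto simp: h_def r_def dist_commute)
  have pzw: "p (z, w) = n * r + n * r"
    using n \<open>r > 0\<close> by (simp add: p g_def hzw algebra_simps)
  \<comment> \<open>The signed difference pins down the order of the pair; the absolute value is
    recovered by swapping \<open>x\<close> and \<open>y\<close>.\<close>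
  have key: "d (x, y) + (g x - g y) \<le> d (z, w) + p (z, w)"
    "d (x, y) + (g x - g y) = d (z, w) + p (z, w) \<Longrightarrow> x = z \<and> y = w" for x y
  proof -
    have "d (x, y) \<le> d (x, z) + (d (z, w) + d (w, y))"
      using PM_triangle[OF PM(1), of x y z] PM_triangle[OF PM(1), of z y w] by linarith
    also have "\<dots> \<le> k * dist x z + (d (z, w) + k * dist y w)"
      using k(2)[of x z] k(2)[of w y] by (simp add: dist_commute)
    finally have 1: "d (x, y) \<le> d (z, w) + k * dist x z + k * dist y w"
      by simp
    have 2: "g x - g y \<le> n * h z x + n * h w y"
      using n h(1)[of w x] h(1)[of z y] by (simp add: g_def algebra_simps)
    show "d (x, y) + (g x - g y) \<le> d (z, w) + p (z, w)"
      using 1 2 nh(1)[of z x] nh(1)[of w y] pzw by linarith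
    assume "d (x, y) + (g x - g y) = d (z, w) + p (z, w)"
    then have "n * h z x + k * dist x z = n * r \<and> n * h w y + k * dist y w = n * r"
      using 1 2 nh(1)[of z x] nh(1)[of w y] pzw by linarith
    then show "x = z \<and> y = w"
      using nh(2) by blast
  qed
  have le: "(d + p) (x, y) \<le> (d + p) (z, w)" for x y
    using key(1)[of x y] key(1)[of y x] PM_sym[OF PM(1), of x y] by (auto simp: p(2) abs_if)
  then have norm: "norm (d + p) = (d + p) (z, w)"
    using PM by (intro norm_eq_max)
  show ?thesis
  proof (rule that[OF p(1) _ norm])
    have "p (x, y) \<le> p (z, w)" for x y
    proof -
      have "n * h v u \<le> n * r" "0 \<le> n * h v u" for v u
        using h n by auto
      from this[of z x] this[of w x] this[of z y] this[of w y] show ?thesis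
        unfolding pzw unfolding p(2) g_def right_diff_distrib by linarith
    qed
    then show "norm p = p (z, w)"
      using PM by (intro norm_eq_max)
    show "{x, y} = {z, w}" if "(d + p) (x, y) = norm (d + p)" for x y
    proof -
      have "d (x, y) + \<bar>g x - g y\<bar> = d (z, w) + p (z, w)"
        using that norm by (simp add: p(2))
      then have "d (x, y) + (g x - g y) = d (z, w) + p (z, w) \<or> d (y, x) + (g y - g x) = d (z, w) + p (z, w)"
        using PM_sym[OF PM(1), of x y] by linarith
      then show ?thesis
        using key(2)[of x y] key(2)[of y x] by auto
    qed
  qed
qed

lemma LPM_peak:
  fixes z w :: "'a::metric_space"
  assumes "bounded (UNIV :: 'a set)" "z \<noteq> w"
  obtains p where "p \<in> LPM" "norm p = p (z, w)" "\<And>x y. p (x, y) = norm p \<Longrightarrow> {x, y} = {z, w}"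
  using LPM_add_peak[OF assms(1) zero_LPM assms(2)] by (metis add_0)

lemma LPM_peak_pos:
  assumes "p \<in> LPM" "\<And>x y. p (x, y) = norm p \<Longrightarrow> {x, y} = {z, w}" "z \<noteq> w"
  shows "norm p > 0"
proof -
  have "p (z, z) \<noteq> norm p"
    using assms(2)[of z z] assms(3) by auto
  then show ?thesis
    using assms(1) LPM_subset_PM PM_self by force
qed

text \<open>Tested on a \<open>p\<close> peaking exactly at \<open>{z, w}\<close>, the inequality
  makes \<open>(z', w')\<close> a peak of \<open>p\<close> too.\<close>

lemma doubleton_eq_of_LPM_le:
  fixes z w :: "'a::metric_space"
  assumes "bounded (UNIV :: 'a set)" "z \<noteq> w" "\<And>d. d \<in> LPM \<Longrightarrow> d (z, w) \<le> d (z', w')"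
  shows "{z', w'} = {z, w}"
  using LPM_peak[OF assms(1,2)] assms(3) apply_bcontfun_le_norm by (metis order_antisym)

text \<open>Read \<open>{a, a'}\<close> and \<open>{b, b'}\<close> as edges. On cut pseudometrics
  the inequality says that every cut between \<open>x\<close> and \<open>x'\<close> separates the
  ends of one of the edges, so the edges connect \<open>x\<close> to \<open>x'\<close>. As neither
  of them is \<open>{x, x'}\<close>, they form a path through one further point
  \<open>s\<close>.\<close>

lemma triangle_of_LPM_le:
  fixes x x' :: "'a::metric_space"
  assumes le: "\<And>d. d \<in> LPM \<Longrightarrow> d (x, x') \<le> d (a, a') + d (b, b')"
    and "x \<noteq> x'" "{a, a'} \<noteq> {x, x'}" "{b, b'} \<noteq> {x, x'}"
  obtains s where "s \<noteq> x" "s \<noteq> x'"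
    "{a, a'} = {x, s} \<and> {b, b'} = {x', s} \<or> {a, a'} = {x', s} \<and> {b, b'} = {x, s}"
proof -
  have cut: "A \<inter> {a, a'} \<noteq> {} \<and> B \<inter> {a, a'} \<noteq> {} \<or> A \<inter> {b, b'} \<noteq> {} \<and> B \<inter> {b, b'} \<noteq> {}"
    if AB: "finite A" "finite B" "A \<inter> B = {}" "x \<in> A" "x' \<in> B" "{a, a', b, b'} \<subseteq> A \<union> B" for A B
  proof -
    obtain d r where d: "d \<in> LPM" "r > 0" "\<And>a b. a \<in> A \<Longrightarrow> b \<in> B \<Longrightarrow> d (a, b) = r"
      "\<And>a a'. a \<in> A \<Longrightarrow> a' \<in> A \<Longrightarrow> d (a, a') = 0" "\<And>b b'. b \<in> B \<Longrightarrow> b' \<in> B \<Longrightarrow> d (b, b') = 0"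
      using LPM_cut[of A B] AB by (metis empty_iff)
    show ?thesis
    proof (rule ccontr)
      assume "\<not> ?thesis"
      then have "a \<in> A \<and> a' \<in> A \<or> a \<in> B \<and> a' \<in> B" "b \<in> A \<and> b' \<in> A \<or> b \<in> B \<and> b' \<in> B"
        using AB by blast+
      then have "d (a, a') = 0" "d (b, b') = 0"
        using d by blast+
      then show False
        using le[OF d(1)] d(2,3) AB by force
    qed
  qed
  \<comment> \<open>Cutting off \<open>x\<close> alone, then \<open>x'\<close> alone, shows that
    each is an end of some edge.\<close>
  have "x \<in> {a, a', b, b'}"
    using cut[of "{x}" "{x', a, a', b, b'} - {x}"] \<open>x \<noteq> x'\<close> by blast
  moreover have "x' \<in> {a, a', b, b'}"
    using cut[of "{x, a, a', b, b'} - {x'}" "{x'}"] \<open>x \<noteq> x'\<close> by blast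
  ultimately have "x \<in> {a, a'} \<and> x' \<in> {b, b'} \<or> x' \<in> {a, a'} \<and> x \<in> {b, b'}"
    using assms(2-4) by (auto simp: doubleton_eq_iff)
  moreover have "\<exists>s. {c, c'} = {y, s}" if "y \<in> {c, c'}" for y c c' :: 'a
    using that by (auto simp: doubleton_eq_iff)
  ultimately obtain s t where st:
    "{a, a'} = {x, s} \<and> {b, b'} = {x', t} \<or> {a, a'} = {x', t} \<and> {b, b'} = {x, s}"
    by metis
  then have "s \<noteq> x'" "t \<noteq> x"
    using assms(3,4) by (auto simp: doubleton_eq_iff)
  \<comment> \<open>Otherwise the cut between \<open>{x, s}\<close> and \<open>{x', t}\<close>
    leaves both edges intact.\<close>
  have "s = t"
  proof (rule ccontr)
    assume "s \<noteq> t"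
    then have disj: "{x, s} \<inter> {x', t} = {}"
      using \<open>s \<noteq> x'\<close> \<open>t \<noteq> x\<close> \<open>x \<noteq> x'\<close> by auto
    have "{a, a', b, b'} = {a, a'} \<union> {b, b'}"
      by auto
    also have "\<dots> \<subseteq> {x, s} \<union> {x', t}"
      using st by fastforce
    finally have "{x, s} \<inter> {a, a'} \<noteq> {} \<and> {x', t} \<inter> {a, a'} \<noteq> {} \<or>
        {x, s} \<inter> {b, b'} \<noteq> {} \<and> {x', t} \<inter> {b, b'} \<noteq> {}"
      using disj by (intro cut) simp_all
    then show False
      using disj st by (metis Int_commute)
  qed
  then have "s \<noteq> x"
    using \<open>t \<noteq> x\<close> by simp
  then show ?thesis
    using \<open>s \<noteq> x'\<close> st[folded \<open>s = t\<close>] by (rule that)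
qed

section \<open>Correspondence of doubletons\<close>

text \<open>This isolates what the argument takes from \<open>Pc\<close> and \<open>Pp\<close>, so
  that both are treated at once: compact peak sets for the finite intersection property, enough
  members with a single peak doubleton, and sums over a common peak.\<close>

definition peak_class :: "(('a::metric_space \<times> 'a) \<Rightarrow>\<^sub>C real) set \<Rightarrow> bool" where
  "peak_class P \<longleftrightarrow>
     (\<forall>d\<in>P. {u. apply_bcontfun d u = norm d} \<noteq> {} \<and> compact {u. apply_bcontfun d u = norm d}) \<and>
     (\<forall>d\<in>LPM. \<forall>z w. z \<noteq> w \<and> apply_bcontfun d (z, w) = norm d \<and> (\<forall>x y. apply_bcontfun d (x, y) = norm d \<longrightarrow> {x, y} = {z, w})
        \<longrightarrow> d \<in> P) \<and>
     (\<forall>d\<in>P. \<forall>e\<in>P. \<forall>u. apply_bcontfun d u = norm d \<and> apply_bcontfun e u = norm e \<longrightarrow> d + e \<in> P)"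

lemma peak_class_attained:
  assumes "peak_class P" "d \<in> P"
  obtains u where "d u = norm d"
  using assms unfolding peak_class_def by fast

lemma peak_class_compact: "peak_class P \<Longrightarrow> d \<in> P \<Longrightarrow> compact {u. d u = norm d}"
  unfolding peak_class_def by simp

lemma peak_class_mem:
  assumes "peak_class P" "d \<in> LPM" "z \<noteq> w" "d (z, w) = norm d"
    "\<And>x y. d (x, y) = norm d \<Longrightarrow> {x, y} = {z, w}"
  shows "d \<in> P"
proof -
  have "\<forall>x y. d (x, y) = norm d \<longrightarrow> {x, y} = {z, w}"
    using assms(5) by (intro allI impI)
  then show ?thesis
    using assms(1-4) unfolding peak_class_def by blast
qed

lemma peak_class_add:
  assumes "peak_class P" "d \<in> P" "e \<in> P" "d u = norm d" "e u = norm e"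
  shows "d + e \<in> P"
proof -
  have "\<forall>d\<in>P. \<forall>e\<in>P. \<forall>u. apply_bcontfun d u = norm d \<and> apply_bcontfun e u = norm e \<longrightarrow> d + e \<in> P"
    using assms(1) unfolding peak_class_def by (elim conjE)
  then show ?thesis
    using assms(2-5) by metis
qed

lemma norm_add_common_peak:
  fixes d e :: "'a::topological_space \<Rightarrow>\<^sub>C real"
  assumes "d u = norm d" "e u = norm e"
  shows "norm (d + e) = norm d + norm e"
  using assms apply_bcontfun_le_norm[of "d + e" u] norm_triangle_ineq[of d e] by simp

text \<open>At a common peak the norms add up, so a peak of the sum leaves no slack in either
  summand.\<close>

lemma add_peak_iff:
  fixes d e :: "'a::topological_space \<Rightarrow>\<^sub>C real"
  assumes "d u = norm d" "e u = norm e"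
  shows "(d + e) v = norm (d + e) \<longleftrightarrow> d v = norm d \<and> e v = norm e"
  using norm_add_common_peak[OF assms] apply_bcontfun_le_norm[of d v] apply_bcontfun_le_norm[of e v]
  by auto

text \<open>Trades uniqueness of an unordered pair, a statement about sets, for one about
  points.\<close>

lemma Pp_iff:
  "d \<in> Pp \<longleftrightarrow> d \<in> PM \<and> (\<exists>z w. d (z, w) = norm d \<and> (\<forall>x y. d (x, y) = norm d \<longrightarrow> {x, y} = {z, w}))"
proof
  assume "d \<in> Pp"
  then obtain A where A: "\<exists>z w. A = {z, w} \<and> d (z, w) = norm d"
    "\<And>B. \<exists>z w. B = {z, w} \<and> d (z, w) = norm d \<Longrightarrow> B = A" and "d \<in> PM"
    unfolding Pp_def by (elim CollectE conjE ex1E) metis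
  then show "d \<in> PM \<and> (\<exists>z w. d (z, w) = norm d \<and> (\<forall>x y. d (x, y) = norm d \<longrightarrow> {x, y} = {z, w}))"
    by metis
next
  assume *: "d \<in> PM \<and> (\<exists>z w. d (z, w) = norm d \<and> (\<forall>x y. d (x, y) = norm d \<longrightarrow> {x, y} = {z, w}))"
  then obtain z w where "d (z, w) = norm d" "\<And>x y. d (x, y) = norm d \<Longrightarrow> {x, y} = {z, w}"
    by metis
  then have "\<exists>!A. \<exists>z w. A = {z, w} \<and> d (z, w) = norm d"
    by (intro ex1I[of _ "{z, w}"]) metis+
  with * show "d \<in> Pp"
    by (simp add: Pp_def)
qed

text \<open>The peak set has at most two elements as a set of ordered pairs. A common peak of two
  members determines the doubleton for both, hence for the sum.\<close>

lemma peak_class_Pp: "peak_class Pp"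
  unfolding peak_class_def
proof (intro conjI ballI allI impI)
  fix d :: "('a \<times> 'a) \<Rightarrow>\<^sub>C real" assume "d \<in> Pp"
  then obtain z w where zw: "d (z, w) = norm d" "\<And>x y. d (x, y) = norm d \<Longrightarrow> {x, y} = {z, w}"
    unfolding Pp_iff by blast
  then show "{u. d u = norm d} \<noteq> {}"
    by blast
  have "{u. d u = norm d} \<subseteq> {(z, w), (w, z)}"
    using zw(2) by (auto simp: doubleton_eq_iff)
  then show "compact {u. d u = norm d}"
    using finite_imp_compact finite_subset by blast
next
  fix d :: "('a \<times> 'a) \<Rightarrow>\<^sub>C real" and z w
  assume "d \<in> LPM" "z \<noteq> w \<and> d (z, w) = norm d \<and> (\<forall>x y. d (x, y) = norm d \<longrightarrow> {x, y} = {z, w})"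
  then show "d \<in> Pp"
    using LPM_subset_PM unfolding Pp_iff by blast
next
  fix d e :: "('a \<times> 'a) \<Rightarrow>\<^sub>C real" and u
  assume de: "d \<in> Pp" "e \<in> Pp" and u: "d u = norm d \<and> e u = norm e"
  then obtain z w where "\<And>x y. d (x, y) = norm d \<Longrightarrow> {x, y} = {z, w}"
    unfolding Pp_iff by blast
  then have "\<And>x y. d (x, y) = norm d \<Longrightarrow> {x, y} = {fst u, snd u}"
    using u by (metis prod.collapse)
  then have "\<And>x y. (d + e) (x, y) = norm (d + e) \<Longrightarrow> {x, y} = {fst u, snd u}"
    using u add_peak_iff by blast
  moreover have "(d + e) (fst u, snd u) = norm (d + e)"
    using u add_peak_iff by (metis prod.collapse)
  moreover have "d + e \<in> PM"
    using de PM_add by (auto simp: Pp_iff)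
  ultimately show "d + e \<in> Pp"
    unfolding Pp_iff by blast
qed

text \<open>The peak set is closed in \<open>K \<times> K\<close>. Peaks of a sum are peaks of
  \<open>d\<close>, so the compact set of \<open>d\<close> serves the sum.\<close>

lemma peak_class_Pc: "peak_class Pc"
  unfolding peak_class_def
proof (intro conjI ballI allI impI)
  fix d :: "('a \<times> 'a) \<Rightarrow>\<^sub>C real" assume "d \<in> Pc"
  then obtain z w K where K: "d (z, w) = norm d" "compact K"
    "\<And>x y. d (x, y) = norm d \<Longrightarrow> x \<in> K \<and> y \<in> K"
    unfolding Pc_def by blast
  then show "{u. d u = norm d} \<noteq> {}"
    by blast
  have "closed {u. d u = norm d}"
    by (intro closed_Collect_eq) (auto intro: continuous_intros)
  moreover have "{u. d u = norm d} = (K \<times> K) \<inter> {u. d u = norm d}"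
    using K by auto
  ultimately show "compact {u. d u = norm d}"
    using K compact_Int_closed compact_Times by metis
next
  fix d :: "('a \<times> 'a) \<Rightarrow>\<^sub>C real" and z w
  assume *: "d \<in> LPM" "z \<noteq> w \<and> d (z, w) = norm d \<and> (\<forall>x y. d (x, y) = norm d \<longrightarrow> {x, y} = {z, w})"
  then have "\<forall>x y. d (x, y) = norm d \<longrightarrow> x \<in> {z, w} \<and> y \<in> {z, w}"
    by blast
  moreover have "compact {z, w}"
    by (simp add: finite_imp_compact)
  ultimately show "d \<in> Pc"
    using * LPM_subset_PM unfolding Pc_def by blast
next
  fix d e :: "('a \<times> 'a) \<Rightarrow>\<^sub>C real" and u
  assume de: "d \<in> Pc" "e \<in> Pc" and u: "d u = norm d \<and> e u = norm e"
  then have PM: "d \<in> PM" "e \<in> PM" "d + e \<in> PM"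
    using PM_add by (auto simp: Pc_def)
  show "d + e \<in> Pc"
  proof (cases "fst u = snd u")
    \<comment> \<open>A common peak on the diagonal forces both functions to be zero.\<close>
    case True
    then have "norm d = 0" "norm e = 0"
      using u PM_self PM by (metis prod.collapse)+
    then show ?thesis
      using de by simp
  next
    case False
    obtain K where K: "compact K" "\<And>x y. d (x, y) = norm d \<Longrightarrow> x \<in> K \<and> y \<in> K"
      using de(1) unfolding Pc_def by blast
    have "\<And>x y. (d + e) (x, y) = norm (d + e) \<Longrightarrow> x \<in> K \<and> y \<in> K"
      using u add_peak_iff K(2) by blast
    moreover have "(d + e) (fst u, snd u) = norm (d + e)"
      using u add_peak_iff by (metis prod.collapse)
    ultimately show ?thesis
      using PM False K(1) unfolding Pc_def by blast
  qed
qed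

section \<open>Isometries, their inverses and the peaks of images\<close>

lemma isometry_onto_mem: "isometry_onto T A B \<Longrightarrow> d \<in> A \<Longrightarrow> T d \<in> B"
  unfolding isometry_onto_def by blast

lemma isometry_onto_dist: "isometry_onto T A B \<Longrightarrow> d \<in> A \<Longrightarrow> e \<in> A \<Longrightarrow> dist (T d) (T e) = dist d e"
  unfolding isometry_onto_def by blast

lemma isometry_onto_inv_into_left:
  assumes "isometry_onto T A B" "d \<in> A"
  shows "inv_into A T (T d) = d"
proof -
  have "inj_on T A"
    using isometry_onto_dist[OF assms(1)] by (intro inj_onI) (metis dist_eq_0_iff)
  then show ?thesis
    using assms(2) by simp
qed

lemma isometry_onto_inv_into:
  assumes "isometry_onto T A B"
  shows "isometry_onto (inv_into A T) B A"
proof -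
  have B: "T ` A = B"
    using assms by (simp add: isometry_onto_def)
  have "dist (inv_into A T (T d)) (inv_into A T (T e)) = dist (T d) (T e)" if "d \<in> A" "e \<in> A" for d e
    using that isometry_onto_inv_into_left[OF assms] isometry_onto_dist[OF assms] by metis
  moreover have "inv_into A T ` T ` A = A"
    using isometry_onto_inv_into_left[OF assms] by (simp add: image_image)
  ultimately show ?thesis
    unfolding isometry_onto_def by (simp flip: B)
qed

text \<open>The origin is the only point of the cone with respect to which the ultrametric type inequality
  \<open>dist a b \<le> max (norm a) (norm b)\<close> holds, so it is fixed by every isometry.\<close>

lemma isometry_LPM_zero:
  fixes T :: "(('a::metric_space \<times> 'a) \<Rightarrow>\<^sub>C real) \<Rightarrow> (('b::metric_space \<times> 'b) \<Rightarrow>\<^sub>C real)"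
  assumes T: "isometry_onto T LPM LPM"
  shows "T 0 = 0"
proof -
  have le: "dist a b \<le> max (norm a) (norm b)" if "a \<in> LPM" "b \<in> LPM" for a b :: "('a \<times> 'a) \<Rightarrow>\<^sub>C real"
  proof (rule dist_bound)
    fix u
    have "0 \<le> a u" "0 \<le> b u"
      using that LPM_subset_PM PM_nonneg by blast+
    then show "dist (a u) (b u) \<le> max (norm a) (norm b)"
      using apply_bcontfun_le_norm[of a u] apply_bcontfun_le_norm[of b u] by (auto simp: dist_real_def)
  qed
  define c where "c = T 0"
  have "c \<in> LPM"
    unfolding c_def using T zero_LPM by (rule isometry_onto_mem)
  \<comment> \<open>The preimages of 0 and of \<open>2 *\<^sub>R c\<close> both have norm
    \<open>norm c\<close>, while their distance is \<open>2 * norm c\<close>. The inequality then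
    leaves only \<open>c = 0\<close>.\<close>
  then have "0 \<in> T ` LPM" "2 *\<^sub>R c \<in> T ` LPM"
    using T zero_LPM LPM_scaleR[of c 2] by (simp_all add: isometry_onto_def)
  then obtain a b where ab: "a \<in> LPM" "T a = 0" "b \<in> LPM" "T b = 2 *\<^sub>R c"
    by (elim imageE) metis
  have "norm (2 *\<^sub>R c) = dist (T a) (T b)"
    by (simp only: ab dist_norm diff_0 norm_minus_cancel)
  also have "\<dots> \<le> max (dist a 0) (dist b 0)"
    using isometry_onto_dist[OF T ab(1,3)] le[OF ab(1,3)] by simp
  also have "\<dots> = max (dist (T a) (T 0)) (dist (T b) (T 0))"
    using isometry_onto_dist[OF T] ab zero_LPM by metis
  also have "\<dots> = max (norm c) (norm c)"
    unfolding ab c_def[symmetric] by (simp add: dist_norm scaleR_2)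
  finally show ?thesis
    by (simp add: c_def)
qed

lemma isometry_LPM_norm:
  fixes T :: "(('a::metric_space \<times> 'a) \<Rightarrow>\<^sub>C real) \<Rightarrow> (('b::metric_space \<times> 'b) \<Rightarrow>\<^sub>C real)"
  assumes T: "isometry_onto T LPM LPM" and "d \<in> LPM"
  shows "norm (T d) = norm d"
proof -
  have "dist (T d) (T 0) = dist d 0"
    using assms zero_LPM by (intro isometry_onto_dist)
  then show ?thesis
    using isometry_LPM_zero[OF T] by simp
qed

text \<open>Read in the image space, \<open>norm f = norm d + dist f d\<close> forces every peak of \<open>f\<close> to be a peak
  of \<open>d\<close>. For \<open>d\<close> in a finite set of functions with a common peak, \<open>f\<close> can be taken to be their sum.
  So the peak sets of the images have the finite intersection property.\<close>

lemma isometry_peak_family: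
  fixes T :: "(('a::metric_space \<times> 'a) \<Rightarrow>\<^sub>C real) \<Rightarrow> (('b::metric_space \<times> 'b) \<Rightarrow>\<^sub>C real)"
  assumes T: "isometry_onto T LPM LPM" and TP: "T ` (P \<inter> LPM) \<subseteq> Q"
    and P: "peak_class P" and Q: "peak_class Q"
    and bdd: "bounded (UNIV :: 'a set)" and "z \<noteq> w"
  obtains u v where "u \<noteq> v" "\<And>d. d \<in> P \<inter> LPM \<Longrightarrow> d (z, w) = norm d \<Longrightarrow> T d (u, v) = norm d"
proof -
  define F where "F = {d \<in> P \<inter> LPM. d (z, w) = norm d}"
  have P_add: "d + e \<in> F" if "d \<in> F" "e \<in> F" for d e
    using that peak_class_add[OF P, of d e "(z, w)"] LPM_add[of d e] norm_add_common_peak[of d "(z, w)" e]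
    by (simp add: F_def)
  have F_sum: "\<Sum>D \<in> F \<and> norm (\<Sum>D) = sum norm D" if "finite D" "D \<noteq> {}" "D \<subseteq> F" for D
    using that
  proof (induction D rule: finite_ne_induct)
    case (insert d D)
    then have "d \<in> F" "\<Sum>D \<in> F" "norm (\<Sum>D) = sum norm D"
      by auto
    then show ?case
      using insert.hyps P_add norm_add_common_peak[of d "(z, w)" "\<Sum>D"] by (auto simp: F_def)
  qed auto
  define S where "S d = {q. T d q = norm d}" for d
  have fip: "(\<Inter>d\<in>D. S d) \<noteq> {}" if D: "finite D" "D \<noteq> {}" "D \<subseteq> F" for D
  proof -
    define f where "f = \<Sum>D"
    have f: "f \<in> F" "norm f = sum norm D"
      using F_sum[OF D] by (auto simp: f_def)
    then have "T f \<in> Q" "norm (T f) = norm f"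
      using TP isometry_LPM_norm[OF T] by (auto simp: F_def)
    then obtain q where q: "T f q = norm f"
      using peak_class_attained[OF Q] by metis
    have "T d q = norm d" if "d \<in> D" for d
    proof -
      have "dist f d = norm (\<Sum>(D - {d}))"
        using D that by (simp add: dist_norm f_def sum_diff)
      also have "\<dots> \<le> sum norm (D - {d})"
        by (rule norm_sum)
      also have "\<dots> = norm f - norm d"
        using D that by (simp add: f sum_diff)
      finally have "dist (T f) (T d) \<le> norm f - norm d"
        using isometry_onto_dist[OF T, of f d] f D that by (auto simp: F_def)
      then have "norm d \<le> T d q"
        using apply_le_dist_add[of "T f" q "T d"] q by simp
      moreover have "T d q \<le> norm d"
        using apply_bcontfun_le_norm[of "T d" q] isometry_LPM_norm[OF T, of d] D that by (auto simp: F_def)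
      ultimately show ?thesis
        by simp
    qed
    then show ?thesis
      by (auto simp: S_def)
  qed
  \<comment> \<open>One compact peak set suffices, the others being closed; \<open>p\<close>
    supplies it. Since \<open>p\<close> is nonzero, the common peak also lies off the
    diagonal.\<close>
  obtain p where p: "p \<in> LPM" "norm p = p (z, w)" "\<And>x y. p (x, y) = norm p \<Longrightarrow> {x, y} = {z, w}"
    using LPM_peak[OF bdd \<open>z \<noteq> w\<close>] by metis
  have "p \<in> P"
    by (rule peak_class_mem[OF P p(1) \<open>z \<noteq> w\<close> p(2)[symmetric] p(3)])
  then have pF: "p \<in> F"
    using p(1,2) by (simp add: F_def)
  have norm_p: "norm p > 0"
    by (rule LPM_peak_pos[OF p(1,3) \<open>z \<noteq> w\<close>])
  have cpt: "compact (S p)"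
    using pF TP peak_class_compact[OF Q, of "T p"] isometry_LPM_norm[OF T p(1)]
    by (auto simp: F_def S_def)
  have clo: "closed (S d)" for d
    unfolding S_def by (intro closed_Collect_eq) (auto intro: continuous_intros)
  have fip_p: "S p \<inter> (\<Inter>d\<in>D. S d) \<noteq> {}" if "finite D" "D \<subseteq> F" for D
    using fip[of "insert p D"] that pF by simp
  have "S p \<inter> (\<Inter>d\<in>F. S d) \<noteq> {}"
    by (rule compact_imp_fip_image[OF cpt clo fip_p])
  then obtain u v where uv: "\<And>d. d \<in> F \<Longrightarrow> T d (u, v) = norm d"
    by (auto simp: S_def)
  have "T p \<in> PM"
    using isometry_onto_mem[OF T p(1)] LPM_subset_PM by blast
  then have "u \<noteq> v"
    using uv[OF pF] norm_p PM_self by force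
  then show ?thesis
    using that uv by (simp add: F_def)
qed

text \<open>The value of \<open>d\<close> at \<open>(z, w)\<close> is the maximum of \<open>norm e - dist e d\<close> over the functions \<open>e\<close>
  peaking at \<open>(z, w)\<close>; here only one inequality survives the transport along \<open>T\<close>.\<close>

lemma isometry_pair_le:
  fixes T :: "(('a::metric_space \<times> 'a) \<Rightarrow>\<^sub>C real) \<Rightarrow> (('b::metric_space \<times> 'b) \<Rightarrow>\<^sub>C real)"
  assumes T: "isometry_onto T LPM LPM" and TP: "T ` (P \<inter> LPM) \<subseteq> Q"
    and P: "peak_class P" and Q: "peak_class Q"
    and bdd: "bounded (UNIV :: 'a set)" and "z \<noteq> w"
  obtains u v where "u \<noteq> v" "\<And>d. d \<in> LPM \<Longrightarrow> d (z, w) \<le> T d (u, v)"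
proof -
  obtain u v where uv: "u \<noteq> v" "\<And>d. d \<in> P \<inter> LPM \<Longrightarrow> d (z, w) = norm d \<Longrightarrow> T d (u, v) = norm d"
    using isometry_peak_family[OF T TP P Q bdd \<open>z \<noteq> w\<close>] by metis
  have "d (z, w) \<le> T d (u, v)" if d: "d \<in> LPM" for d
  proof -
    obtain p where p: "p \<in> LPM" "norm p = p (z, w)" "norm (d + p) = (d + p) (z, w)"
      "\<And>x y. (d + p) (x, y) = norm (d + p) \<Longrightarrow> {x, y} = {z, w}"
      using LPM_add_peak[OF bdd d \<open>z \<noteq> w\<close>] by metis
    have e: "d + p \<in> P \<inter> LPM"
      using LPM_add[OF d p(1)] peak_class_mem[OF P LPM_add[OF d p(1)] \<open>z \<noteq> w\<close> p(3)[symmetric] p(4)]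
      by (rule IntI[rotated])
    \<comment> \<open>For \<open>e = d + p\<close>, \<open>norm e - dist e d\<close> is exactly
      \<open>d (z, w)\<close>.\<close>
    have "dist (T (d + p)) (T d) = norm p"
      using isometry_onto_dist[OF T _ d, of "d + p"] e by (simp add: dist_norm)
    then show ?thesis
      using uv(2)[OF e] p(2,3) apply_le_dist_add[of "T (d + p)" "(u, v)" "T d"] by simp
  qed
  then show ?thesis
    using that uv by blast
qed

text \<open>Passing through \<open>T\<close> and back gives
  \<open>d (z, w) \<le> T d (u, v) \<le> d (z', w')\<close> for every \<open>d\<close>. The outer
  inequality forces \<open>{z', w'} = {z, w}\<close>, so the chain collapses.\<close>

lemma isometry_pair_eq:
  fixes T :: "(('a::metric_space \<times> 'a) \<Rightarrow>\<^sub>C real) \<Rightarrow> (('b::metric_space \<times> 'b) \<Rightarrow>\<^sub>C real)"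
  assumes T: "isometry_onto T LPM LPM" and TP: "T ` (P \<inter> LPM) = Q \<inter> LPM"
    and P: "peak_class P" and Q: "peak_class Q"
    and bdd: "bounded (UNIV :: 'a set)" "bounded (UNIV :: 'b set)" and "z \<noteq> w"
  obtains u v where "u \<noteq> v" "\<And>d. d \<in> LPM \<Longrightarrow> T d (u, v) = d (z, w)"
proof -
  define T' where "T' = inv_into LPM T"
  have T': "isometry_onto T' LPM LPM"
    using isometry_onto_inv_into[OF T] by (simp add: T'_def)
  have inv: "T' (T d) = d" if "d \<in> LPM" for d
    unfolding T'_def using T that by (rule isometry_onto_inv_into_left)
  then have T'P: "T' ` (Q \<inter> LPM) \<subseteq> P"
    by (auto simp flip: TP)
  obtain u v where uv: "u \<noteq> v" "\<And>d. d \<in> LPM \<Longrightarrow> d (z, w) \<le> T d (u, v)"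
    using isometry_pair_le[OF T _ P Q bdd(1) \<open>z \<noteq> w\<close>] TP by (metis inf_le1)
  obtain z' w' where zw': "\<And>d. d \<in> LPM \<Longrightarrow> d (u, v) \<le> T' d (z', w')"
    using isometry_pair_le[OF T' T'P Q P bdd(2) uv(1)] by metis
  have le: "T d (u, v) \<le> d (z', w')" if "d \<in> LPM" for d
    using zw'[of "T d"] inv that isometry_onto_mem[OF T that] by simp
  have "{z', w'} = {z, w}"
    by (rule doubleton_eq_of_LPM_le[OF bdd(1) \<open>z \<noteq> w\<close> order_trans[OF uv(2) le]])
  then have "T d (u, v) = d (z, w)" if "d \<in> LPM" for d
    using uv(2)[OF that] le[OF that] PM_doubleton_cong[of d z' w' z w] that LPM_subset_PM
    by (intro antisym) auto
  then show ?thesis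
    using that uv(1) by blast
qed

section \<open>The induced point map\<close>

text \<open>Pure combinatorics on the edges of a complete graph, in the spirit of Whitney's theorem
  on line graphs: edges at a vertex \<open>u\<close> go to edges at a common vertex, which becomes
  \<open>\<phi> u\<close>. The obstruction is a star of three edges going to a triangle;
  \<open>star\<close> excludes it.\<close>

lemma point_map_of_pair_relation:
  fixes M :: "'b \<Rightarrow> 'b \<Rightarrow> 'a \<Rightarrow> 'a \<Rightarrow> bool"
  assumes sym: "\<And>u v z w. M u v z w \<Longrightarrow> M v u z w"
    and uniq: "\<And>u v z w z' w'. u \<noteq> v \<Longrightarrow> M u v z w \<Longrightarrow> M u v z' w' \<Longrightarrow> z = z' \<and> w = w' \<or> z = w' \<and> w = z'"
    and tri: "\<And>u v w. u \<noteq> v \<Longrightarrow> u \<noteq> w \<Longrightarrow> v \<noteq> w \<Longrightarrow>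
        \<exists>p q s. p \<noteq> q \<and> p \<noteq> s \<and> q \<noteq> s \<and> M u v p q \<and> M u w p s \<and> M v w q s"
    and star: "\<And>u v v' v'' p q s. v \<noteq> u \<Longrightarrow> v' \<noteq> u \<Longrightarrow> v'' \<noteq> u \<Longrightarrow> v \<noteq> v' \<Longrightarrow> v \<noteq> v'' \<Longrightarrow>
        M u v p q \<Longrightarrow> M u v' p s \<Longrightarrow> M u v'' q s \<Longrightarrow> False"
    and three: "\<And>u v :: 'b. \<exists>w. w \<noteq> u \<and> w \<noteq> v"
  obtains \<phi> where "\<And>u v. u \<noteq> v \<Longrightarrow> \<phi> u \<noteq> \<phi> v \<and> M u v (\<phi> u) (\<phi> v)"
proof -
  have "\<exists>p. \<forall>v. v \<noteq> u \<longrightarrow> (\<exists>x. M u v p x)" for u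
  proof -
    obtain v1 where v1: "v1 \<noteq> u"
      using three by metis
    obtain v2 where v2: "v2 \<noteq> u" "v2 \<noteq> v1"
      using three by metis
    obtain p q s where pqs: "p \<noteq> q" "p \<noteq> s" "q \<noteq> s" "M u v1 p q" "M u v2 p s"
      using tri[of u v1 v2] v1 v2 by metis
    \<comment> \<open>An image of \<open>{u, v}\<close> missing \<open>p\<close> must meet
      \<open>{p, q}\<close> in \<open>q\<close> and \<open>{p, s}\<close> in \<open>s\<close>, so it
      closes a triangle.\<close>
    have "\<exists>x. M u v p x" if v: "v \<noteq> u" for v
    proof (rule ccontr)
      assume not: "\<not> ?thesis"
      then have ne: "v \<noteq> v1" "v \<noteq> v2"
        using pqs by auto
      obtain p1 q1 s1 where 1: "M u v1 p1 q1" "M u v p1 s1"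
        using tri[of u v1 v] v v1 ne by metis
      then have "p1 = q"
        using uniq[OF v1[symmetric] pqs(4) 1(1)] not by auto
      obtain p2 q2 s2 where 2: "M u v2 p2 q2" "M u v p2 s2"
        using tri[of u v2 v] v v2 ne by metis
      then have "p2 = s"
        using uniq[OF v2(1)[symmetric] pqs(5) 2(1)] not by auto
      have "M u v q s"
        using uniq[OF v[symmetric] 1(2) 2(2)] 1 \<open>p1 = q\<close> \<open>p2 = s\<close> pqs(3) by auto
      then show False
        using star[OF v1 v2(1) v v2(2)[symmetric] ne(1)[symmetric] pqs(4,5)] by simp
    qed
    then show ?thesis
      by blast
  qed
  then obtain \<phi> where \<phi>: "\<And>u v. v \<noteq> u \<Longrightarrow> \<exists>x. M u v (\<phi> u) x"
    by metis
  have "\<phi> u \<noteq> \<phi> v \<and> M u v (\<phi> u) (\<phi> v)" if uv: "u \<noteq> v" for u v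
  proof -
    obtain w where w: "w \<noteq> u" "w \<noteq> v"
      using three by metis
    obtain p q s where pqs: "p \<noteq> q" "p \<noteq> s" "q \<noteq> s" "M u v p q" "M u w p s" "M v w q s"
      using tri[of u v w] uv w by metis
    obtain x y x' y' where xy: "M u v (\<phi> u) x" "M v u (\<phi> v) y" "M u w (\<phi> u) x'" "M v w (\<phi> v) y'"
      using \<phi> uv w by metis
    \<comment> \<open>\<open>\<phi> u\<close> lies in \<open>{p, q}\<close> and in
      \<open>{p, s}\<close>, so it is \<open>p\<close>, whereas \<open>\<phi> v\<close> is
      \<open>q\<close> or \<open>s\<close>.\<close>
    have ne: "\<phi> u \<noteq> \<phi> v"
      using uniq[OF uv pqs(4) xy(1)] uniq[OF w(1)[symmetric] pqs(5) xy(3)]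
        uniq[OF w(2)[symmetric] pqs(6) xy(4)] pqs(1-3) by auto
    then have "x = \<phi> v"
      using uniq[OF uv xy(1) sym[OF xy(2)]] by auto
    then show ?thesis
      using ne xy(1) by simp
  qed
  then show ?thesis
    using that by blast
qed

text \<open>\<open>M\<close> is the correspondence of doubletons. Triangle inequalities of
  \<open>T d\<close>, read as inequalities for \<open>d\<close>, show that triangles go to
  triangles; those of \<open>d\<close>, read for \<open>T d\<close>, exclude stars going to
  triangles.\<close>

lemma isometry_point_map:
  fixes T :: "(('a::metric_space \<times> 'a) \<Rightarrow>\<^sub>C real) \<Rightarrow> (('b::metric_space \<times> 'b) \<Rightarrow>\<^sub>C real)"
  assumes T: "T ` LPM = LPM" and bdd: "bounded (UNIV :: 'a set)" "bounded (UNIV :: 'b set)"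
    and nondeg: "\<exists>u v :: 'b. u \<noteq> v"
    and ex_a: "\<And>u v. u \<noteq> v \<Longrightarrow> \<exists>z w. z \<noteq> w \<and> (\<forall>d\<in>LPM. T d (u, v) = d (z, w))"
    and ex_b: "\<And>z w. z \<noteq> w \<Longrightarrow> \<exists>u v. u \<noteq> v \<and> (\<forall>d\<in>LPM. T d (u, v) = d (z, w))"
  obtains \<phi> where "bij \<phi>" "\<And>d u v. d \<in> LPM \<Longrightarrow> T d (u, v) = d (\<phi> u, \<phi> v)"
proof -
  define M where "M u v z w \<longleftrightarrow> (\<forall>d\<in>LPM. apply_bcontfun (T d) (u, v) = apply_bcontfun d (z, w))" for u v z w
  have PM: "d \<in> PM" "T d \<in> PM" if "d \<in> LPM" for d
    using that T LPM_subset_PM by blast+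
  have MD: "T d (u, v) = d (z, w)" if "M u v z w" "d \<in> LPM" for u v z w d
    using that by (simp add: M_def)
  have sym: "M v u z w" "M u v w z" if "M u v z w" for u v z w
    using that PM_sym PM unfolding M_def by metis+
  have cong: "M u v z' w'" if "M u v z w" "{z, w} = {z', w'}" for u v z w z' w'
    using that(2) that(1) sym(2)[OF that(1)] unfolding doubleton_eq_iff by metis
  have uniq: "{z', w'} = {z, w}" if "z \<noteq> w" "M u v z w" "M u v z' w'" for u v z w z' w'
    using MD[OF that(2)] MD[OF that(3)] by (intro doubleton_eq_of_LPM_le[OF bdd(1) that(1)]) (metis order_refl)
  have inj: "{u', v'} = {u, v}" if "u \<noteq> v" "M u v z w" "M u' v' z w" for u v u' v' z w
  proof (rule doubleton_eq_of_LPM_le[OF bdd(2) that(1)])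
    fix e :: "('b \<times> 'b) \<Rightarrow>\<^sub>C real" assume "e \<in> LPM"
    then obtain d where "d \<in> LPM" "e = T d"
      using T by auto
    then show "e (u, v) \<le> e (u', v')"
      using MD that by simp
  qed
  \<comment> \<open>A pair sent to the diagonal would be indistinguishable from
    \<open>(u, u)\<close>, against injectivity.\<close>
  have M_ne: "z \<noteq> w" if "u \<noteq> v" "M u v z w" for u v z w
  proof
    assume "z = w"
    then have "\<forall>d\<in>LPM. T d (u, v) = T d (u, u)"
      using MD[OF that(2)] PM PM_self by metis
    then have "M u u z w"
      using that by (simp add: M_def)
    then show False
      using inj[OF that, of u u] that(1) unfolding doubleton_eq_iff by simp
  qed
  obtain \<phi> where \<phi>: "\<And>u v. u \<noteq> v \<Longrightarrow> \<phi> u \<noteq> \<phi> v \<and> M u v (\<phi> u) (\<phi> v)"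
  proof (cases "\<forall>u v :: 'b. \<exists>w. w \<noteq> u \<and> w \<noteq> v")
    case True
    have tri: "\<exists>p q s. p \<noteq> q \<and> p \<noteq> s \<and> q \<noteq> s \<and> M u v p q \<and> M u w p s \<and> M v w q s"
      if uvw: "u \<noteq> v" "u \<noteq> w" "v \<noteq> w" for u v w
    proof -
      obtain a a' b b' c c' where abc: "M u v a a'" "M u w b b'" "M v w c c'"
        using ex_a uvw unfolding M_def by metis
      have "\<not> M u w a a'" "\<not> M v w a a'"
        using inj[OF uvw(1) abc(1)] uvw unfolding doubleton_eq_iff by metis+
      then have ne: "a \<noteq> a'" "{b, b'} \<noteq> {a, a'}" "{c, c'} \<noteq> {a, a'}"
        using M_ne[OF uvw(1) abc(1)] cong[OF abc(2)] cong[OF abc(3)] by metis+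
      have "d (a, a') \<le> d (b, b') + d (c, c')" if "d \<in> LPM" for d
        using PM_triangle[OF PM(2)[OF that], of u v w] PM_sym[OF PM(2)[OF that], of v w]
        by (simp add: MD[OF abc(1) that] MD[OF abc(2) that] MD[OF abc(3) that])
      then obtain s where s: "s \<noteq> a" "s \<noteq> a'"
        "{b, b'} = {a, s} \<and> {c, c'} = {a', s} \<or> {b, b'} = {a', s} \<and> {c, c'} = {a, s}"
        by (rule triangle_of_LPM_le[OF _ ne])
      from s(3) show ?thesis
      proof
        assume "{b, b'} = {a, s} \<and> {c, c'} = {a', s}"
        then show ?thesis
          using abc(1) cong[OF abc(2)] cong[OF abc(3)] ne(1) s(1,2) by metis
      next
        assume "{b, b'} = {a', s} \<and> {c, c'} = {a, s}"
        then show ?thesis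
          using sym(2)[OF abc(1)] cong[OF abc(2)] cong[OF abc(3)] ne(1) s(1,2) by metis
      qed
    qed
    have star: False if v: "v \<noteq> u" "v' \<noteq> u" "v'' \<noteq> u" "v \<noteq> v'" "v \<noteq> v''"
      and Ms: "M u v p q" "M u v' p s" "M u v'' q s" for u v v' v'' p q s
    proof -
      \<comment> \<open>A triangle \<open>p\<close>, \<open>q\<close>, \<open>s\<close> would make
        \<open>{u, v'}\<close> and \<open>{u, v''}\<close> a path from \<open>u\<close> to
        \<open>v\<close>, but neither contains \<open>v\<close>.\<close>
      have le: "e (u, v) \<le> e (u, v') + e (u, v'')" if e: "e \<in> LPM" for e
      proof -
        obtain d where d: "d \<in> LPM" "e = T d"
          using T e by auto
        then show ?thesis
          using PM_triangle[OF PM(1)[OF d(1)], of p q s] PM_sym[OF PM(1)[OF d(1)], of s q]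
          by (simp add: MD[OF Ms(1)] MD[OF Ms(2)] MD[OF Ms(3)])
      qed
      have "{u, v'} \<noteq> {u, v}" "{u, v''} \<noteq> {u, v}"
        using v by (auto simp: doubleton_eq_iff)
      from triangle_of_LPM_le[OF le v(1)[symmetric] this] show False
        using v by (metis insertE insertI1 singletonD)
    qed
    have uniq': "z = z' \<and> w = w' \<or> z = w' \<and> w = z'" if "u \<noteq> v" "M u v z w" "M u v z' w'" for u v z w z' w'
      using uniq[OF M_ne[OF that(1,2)] that(2,3)] by (auto simp: doubleton_eq_iff)
    show ?thesis
    proof (rule point_map_of_pair_relation[of M])
      show "M v u z w" if "M u v z w" for u v z w
        using that by (rule sym(1))
      show "z = z' \<and> w = w' \<or> z = w' \<and> w = z'" if "u \<noteq> v" "M u v z w" "M u v z' w'" for u v z w z' w'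
        using that by (rule uniq')
      show "\<exists>p q s. p \<noteq> q \<and> p \<noteq> s \<and> q \<noteq> s \<and> M u v p q \<and> M u w p s \<and> M v w q s"
        if "u \<noteq> v" "u \<noteq> w" "v \<noteq> w" for u v w
        using that by (rule tri)
      show False if "v \<noteq> u" "v' \<noteq> u" "v'' \<noteq> u" "v \<noteq> v'" "v \<noteq> v''"
        "M u v p q" "M u v' p s" "M u v'' q s" for u v v' v'' p q s
        using that by (rule star)
      show "\<exists>w. w \<noteq> u \<and> w \<noteq> v" for u v :: 'b
        using True by blast
    qed (rule that)
  next
    case False
    then obtain u v :: 'b where two: "\<And>x. x = u \<or> x = v"
      by metis
    then have "u \<noteq> v"
      using nondeg by metis
    then obtain z w where zw: "z \<noteq> w" "M u v z w"
      using ex_a unfolding M_def by metis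
    then have "M v u w z"
      using sym by blast
    \<comment> \<open>There is only one doubleton to match, and by symmetry of \<open>M\<close>
      either assignment of its points works.\<close>
    show ?thesis
    proof (rule that[of "\<lambda>x. if x = u then z else w"])
      fix x y :: 'b assume "x \<noteq> y"
      then consider "x = u" "y = v" | "x = v" "y = u"
        using two by metis
      then show "(if x = u then z else w) \<noteq> (if y = u then z else w) \<and>
          M x y (if x = u then z else w) (if y = u then z else w)"
        using zw \<open>M v u w z\<close> \<open>u \<noteq> v\<close> by cases simp_all
    qed
  qed
  have "inj \<phi>"
    using \<phi> by (intro injI) metis
  moreover have "z \<in> range \<phi>" for z
  proof -
    obtain u v :: 'b where "u \<noteq> v"
      using nondeg by metis
    then obtain w where "w \<noteq> z"
      using \<phi> by metis
    then obtain u' v' where u': "u' \<noteq> v'" "M u' v' z w"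
      using ex_b[of z w] unfolding M_def by metis
    then have "{z, w} = {\<phi> u', \<phi> v'}"
      using uniq \<phi> by metis
    then show ?thesis
      by (auto simp: doubleton_eq_iff)
  qed
  ultimately have "bij \<phi>"
    by (auto simp: bij_def)
  moreover have "T d (u, v) = d (\<phi> u, \<phi> v)" if "d \<in> LPM" for d u v
    using \<phi>[of u v] MD[of u v "\<phi> u" "\<phi> v" d] PM_self[OF PM(1)[OF that]] PM_self[OF PM(2)[OF that]] that
    by (cases "u = v") simp_all
  ultimately show ?thesis
    using that by blast
qed

text \<open>Boundedness of the space turns its metric into a test function.\<close>

lemma dist_LPM:
  assumes "bounded (UNIV :: 'a::metric_space set)"
  obtains d where "d \<in> LPM" "\<And>x y :: 'a. d (x, y) = dist x y"
proof -
  have "\<exists>b. \<forall>x y :: 'a. dist x y \<le> b"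
    using assms by (auto simp: bounded_two_points)
  then have "bounded (range (\<lambda>(x, y :: 'a). dist x y))"
    by (auto simp: bounded_iff)
  moreover have "lipschitz_pseudometric (\<lambda>x y :: 'a. dist x y)"
    by (auto simp: lipschitz_pseudometric_def pseudometric_def dist_commute dist_triangle intro!: exI[of _ 1])
  ultimately obtain d where "d \<in> LPM" "\<forall>x y :: 'a. d (x, y) = dist x y"
    using bounded_lipschitz_pseudometric_in_LPM[of "\<lambda>x y :: 'a. dist x y"] by auto
  then show ?thesis
    using that by blast
qed

text \<open>The image of the metric of \<open>'a\<close> is lipschitz, which bounds
  \<open>\<phi>\<close> from above; the preimage of the metric of \<open>'b\<close> is lipschitz,
  which bounds it from below.\<close>

lemma bi_lipschitz_of_LPM_pullback:
  fixes \<phi> :: "'b::metric_space \<Rightarrow> 'a::metric_space"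
  assumes T: "T ` LPM = LPM" and bdd: "bounded (UNIV :: 'a set)" "bounded (UNIV :: 'b set)"
    and \<phi>: "bij \<phi>" "\<And>d u v. d \<in> LPM \<Longrightarrow> T d (u, v) = d (\<phi> u, \<phi> v)"
  shows "bi_lipschitz \<phi>"
proof -
  obtain d where d: "d \<in> LPM" "\<And>x y :: 'a. d (x, y) = dist x y"
    using dist_LPM[OF bdd(1)] by metis
  obtain e where e: "e \<in> LPM" "\<And>x y :: 'b. e (x, y) = dist x y"
    using dist_LPM[OF bdd(2)] by metis
  obtain e' where e': "e' \<in> LPM" "e = T e'"
    using e(1) T by (metis imageE)
  have "T d \<in> LPM"
    using d T by auto
  then obtain k where k: "k > 0" "\<And>x y. T d (x, y) \<le> k * dist x y"
    unfolding LPM_iff by metis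
  obtain l where l: "l > 0" "\<And>x y. e' (x, y) \<le> l * dist x y"
    using e'(1) unfolding LPM_iff by metis
  define m where "m = max 1 (max k l)"
  have m: "1 \<le> m" "k \<le> m" "l \<le> m"
    by (auto simp: m_def)
  have "dist x y \<le> m * dist (\<phi> x) (\<phi> y)" "dist (\<phi> x) (\<phi> y) \<le> m * dist x y" for x y
  proof -
    have "dist x y \<le> l * dist (\<phi> x) (\<phi> y)"
      using l(2)[of "\<phi> x" "\<phi> y"] \<phi>(2)[OF e'(1), of x y] e(2)[of x y] e'(2) by simp
    also have "\<dots> \<le> m * dist (\<phi> x) (\<phi> y)"
      using m by (intro mult_right_mono) auto
    finally show "dist x y \<le> m * dist (\<phi> x) (\<phi> y)" .
    have "dist (\<phi> x) (\<phi> y) \<le> k * dist x y"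
      using k(2)[of x y] \<phi>(2)[OF d(1), of x y] d(2) by simp
    also have "\<dots> \<le> m * dist x y"
      using m by (intro mult_right_mono) auto
    finally show "dist (\<phi> x) (\<phi> y) \<le> m * dist x y" .
  qed
  then show ?thesis
    using \<phi>(1) m by (auto simp: bi_lipschitz_def field_simps intro!: exI[of _ m])
qed

section \<open>Pullbacks\<close>

text \<open>\<open>Bcontfun\<close> is meaningful only on bounded continuous functions, hence the
  continuity assumption in the evaluation rule.\<close>

definition pullback ::
    "('b::topological_space \<Rightarrow> 'a::topological_space) \<Rightarrow> (('a \<times> 'a) \<Rightarrow>\<^sub>C real) \<Rightarrow> (('b \<times> 'b) \<Rightarrow>\<^sub>C real)" where
  "pullback \<phi> d = Bcontfun (\<lambda>u. d (map_prod \<phi> \<phi> u))"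

lemma apply_pullback:
  assumes "continuous_on UNIV \<phi>"
  shows "pullback \<phi> d (x, y) = d (\<phi> x, \<phi> y)"
proof -
  have "continuous_on UNIV (\<lambda>u. map_prod \<phi> \<phi> u)"
    unfolding map_prod_def case_prod_beta
    by (intro continuous_on_Pair continuous_on_compose2[OF assms] continuous_intros) auto
  then have "continuous_on UNIV (\<lambda>u. d (map_prod \<phi> \<phi> u))"
    by (rule continuous_on_compose2[rotated]) auto
  then have "(\<lambda>u. d (map_prod \<phi> \<phi> u)) \<in> bcontfun"
    by (rule bcontfun_normI) (rule norm_bounded)
  then show ?thesis
    by (simp add: pullback_def Bcontfun_inverse)
qed

lemma pullback_inverse:
  assumes "continuous_on UNIV \<phi>" "continuous_on UNIV \<psi>" "\<And>x. \<phi> (\<psi> x) = x"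
  shows "pullback \<psi> (pullback \<phi> d) = d"
  by (rule bcontfun_eqI) (metis apply_pullback assms prod.collapse)

lemma dist_pullback_le:
  assumes "continuous_on UNIV \<phi>"
  shows "dist (pullback \<phi> d) (pullback \<phi> e) \<le> dist d e"
proof (rule dist_bound)
  show "dist (pullback \<phi> d u) (pullback \<phi> e u) \<le> dist d e" for u
    using dist_bounded[of d "map_prod \<phi> \<phi> u" e] by (cases u) (simp add: apply_pullback assms)
qed

text \<open>Pullbacks do not increase distances, and pulling back along \<open>\<psi>\<close> undoes
  pulling back along \<open>\<phi>\<close>.\<close>

lemma dist_pullback:
  assumes "continuous_on UNIV \<phi>" "continuous_on UNIV \<psi>" "\<And>x. \<phi> (\<psi> x) = x"
  shows "dist (pullback \<phi> d) (pullback \<phi> e) = dist d e"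
  using dist_pullback_le[OF assms(1), of d e] dist_pullback_le[OF assms(2), of "pullback \<phi> d" "pullback \<phi> e"]
  by (simp add: pullback_inverse[OF assms])

lemma norm_pullback:
  assumes "continuous_on UNIV \<phi>" "continuous_on UNIV \<psi>" "\<And>x. \<phi> (\<psi> x) = x"
  shows "norm (pullback \<phi> d) = norm d"
proof -
  have "pullback \<phi> 0 = 0"
    by (rule bcontfun_eqI) (simp add: apply_pullback assms split_paired_all)
  then show ?thesis
    using dist_pullback[OF assms, of d 0] by simp
qed

lemma pullback_PM: "continuous_on UNIV \<phi> \<Longrightarrow> d \<in> PM \<Longrightarrow> pullback \<phi> d \<in> PM"
  by (simp add: PM_def apply_pullback pseudometric_def)

lemma pullback_LPM:
  assumes "continuous_on UNIV \<phi>" "\<And>x y. dist (\<phi> x) (\<phi> y) \<le> l * dist x y" "d \<in> LPM" "0 < l"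
  shows "pullback \<phi> d \<in> LPM"
proof -
  obtain k where k: "k > 0" "\<And>x y. d (x, y) \<le> k * dist x y"
    using assms(3) unfolding LPM_iff by metis
  have "pullback \<phi> d (x, y) \<le> (k * l) * dist x y" for x y
    unfolding apply_pullback[OF assms(1)] mult.assoc
    by (rule order_trans[OF k(2) mult_left_mono[OF assms(2)]]) (use k(1) in simp)
  moreover have "pullback \<phi> d \<in> PM"
    using assms pullback_PM LPM_subset_PM by blast
  ultimately show ?thesis
    using k(1) assms(4) by (auto simp: LPM_iff PM_def intro!: exI[of _ "k * l"])
qed

lemma pullback_Pp:
  assumes "continuous_on UNIV \<phi>" "continuous_on UNIV \<psi>" "\<And>x. \<phi> (\<psi> x) = x" "\<And>x. \<psi> (\<phi> x) = x" "d \<in> Pp"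
  shows "pullback \<phi> d \<in> Pp"
proof -
  obtain z w where zw: "d (z, w) = norm d" "\<And>x y. d (x, y) = norm d \<Longrightarrow> {x, y} = {z, w}"
    using assms(5) unfolding Pp_iff by metis
  have "{x, y} = {\<psi> z, \<psi> w}" if "d (\<phi> x, \<phi> y) = norm d" for x y
  proof -
    have "\<psi> ` {\<phi> x, \<phi> y} = \<psi> ` {z, w}"
      by (simp only: zw(2)[OF that])
    then show ?thesis
      by (simp add: assms(4))
  qed
  moreover have "d (\<phi> (\<psi> z), \<phi> (\<psi> w)) = norm d"
    by (simp add: assms(3) zw(1))
  ultimately show ?thesis
    using assms(5) pullback_PM[OF assms(1)]
    unfolding Pp_iff apply_pullback[OF assms(1)] norm_pullback[OF assms(1-3)] by metis
qed

lemma pullback_Pc: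
  assumes "continuous_on UNIV \<phi>" "continuous_on UNIV \<psi>" "\<And>x. \<phi> (\<psi> x) = x" "\<And>x. \<psi> (\<phi> x) = x" "d \<in> Pc"
  shows "pullback \<phi> d \<in> Pc"
proof -
  obtain z w K where K: "z \<noteq> w" "d (z, w) = norm d" "compact K" "d \<in> PM"
    "\<And>x y. d (x, y) = norm d \<Longrightarrow> x \<in> K \<and> y \<in> K"
    using assms(5) unfolding Pc_def by blast
  have "compact (\<psi> ` K)"
    using compact_continuous_image[OF continuous_on_subset[OF assms(2)] K(3)] by simp
  moreover have "x \<in> \<psi> ` K \<and> y \<in> \<psi> ` K" if "d (\<phi> x, \<phi> y) = norm d" for x y
    using K(5)[OF that] assms(4) by (metis imageI)
  moreover have "\<psi> z \<noteq> \<psi> w" "d (\<phi> (\<psi> z), \<phi> (\<psi> w)) = norm d"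
    using K(1,2) assms(3) by metis+
  ultimately show ?thesis
    using pullback_PM[OF assms(1) K(4)]
    unfolding Pc_def apply_pullback[OF assms(1)] norm_pullback[OF assms(1-3)] mem_Collect_eq by metis
qed

lemma isometry_of_bi_lipschitz:
  fixes \<phi> :: "'b::metric_space \<Rightarrow> 'a::metric_space"
    and P :: "(('a \<times> 'a) \<Rightarrow>\<^sub>C real) set" and Q :: "(('b \<times> 'b) \<Rightarrow>\<^sub>C real) set"
  assumes "bi_lipschitz \<phi>" and PQ: "(P = Pc \<and> Q = Pc) \<or> (P = Pp \<and> Q = Pp)"
  obtains T where "isometry_onto T LPM LPM" "T ` (P \<inter> LPM) = Q \<inter> LPM"
proof -
  obtain l where \<phi>: "bij \<phi>" "l \<ge> 1" "\<And>x y. (1 / l) * dist x y \<le> dist (\<phi> x) (\<phi> y)"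
    "\<And>x y. dist (\<phi> x) (\<phi> y) \<le> l * dist x y"
    using assms(1) unfolding bi_lipschitz_def by metis
  define \<psi> where "\<psi> = inv \<phi>"
  have inv: "\<phi> (\<psi> x) = x" "\<psi> (\<phi> y) = y" for x y
    using \<phi>(1) by (simp_all add: \<psi>_def bij_is_inj bij_is_surj surj_f_inv_f)
  have lip: "dist (\<psi> x) (\<psi> y) \<le> l * dist x y" for x y
    using \<phi>(2) \<phi>(3)[of "\<psi> x" "\<psi> y"] by (simp add: inv field_simps)
  have cont: "continuous_on UNIV \<phi>" "continuous_on UNIV \<psi>"
    using \<phi>(2,4) lip by (auto intro!: lipschitz_on_continuous_on[of l] lipschitz_onI)
  have LPM: "pullback \<phi> d \<in> LPM" if "d \<in> LPM" for d
    by (rule pullback_LPM[OF cont(1) \<phi>(4) that]) (use \<phi>(2) in simp)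
  have LPM': "pullback \<psi> e \<in> LPM" if "e \<in> LPM" for e
    by (rule pullback_LPM[OF cont(2) lip that]) (use \<phi>(2) in simp)
  \<comment> \<open>Serves twice, for \<open>LPM\<close> and for its intersection with
    \<open>P\<close>.\<close>
  have image: "pullback \<phi> ` A = B"
    if "\<And>d. d \<in> A \<Longrightarrow> pullback \<phi> d \<in> B" "\<And>e. e \<in> B \<Longrightarrow> pullback \<psi> e \<in> A" for A B
  proof
    show "B \<subseteq> pullback \<phi> ` A"
    proof
      fix e assume "e \<in> B"
      then have "pullback \<psi> e \<in> A" "e = pullback \<phi> (pullback \<psi> e)"
        using that(2) by (simp_all add: pullback_inverse[OF cont(2,1) inv(2)])
      then show "e \<in> pullback \<phi> ` A"
        by (rule rev_image_eqI)
    qed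
  qed (use that(1) in blast)
  show ?thesis
  proof (rule that[of "pullback \<phi>"])
    show "isometry_onto (pullback \<phi>) LPM LPM"
      unfolding isometry_onto_def
      using image[of LPM LPM, OF LPM LPM'] dist_pullback[OF cont inv(1)] by metis
    have "pullback \<phi> d \<in> Q \<inter> LPM" if "d \<in> P \<inter> LPM" for d
    proof
      show "pullback \<phi> d \<in> Q"
        using that PQ pullback_Pc[OF cont inv] pullback_Pp[OF cont inv] by (metis IntD1)
      show "pullback \<phi> d \<in> LPM"
        using that LPM by simp
    qed
    moreover have "pullback \<psi> e \<in> P \<inter> LPM" if "e \<in> Q \<inter> LPM" for e
    proof
      show "pullback \<psi> e \<in> P"
        using that PQ pullback_Pc[OF cont(2,1) inv(2,1)] pullback_Pp[OF cont(2,1) inv(2,1)] by (metis IntD1)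
      show "pullback \<psi> e \<in> LPM"
        using that LPM' by simp
    qed
    ultimately show "pullback \<phi> ` (P \<inter> LPM) = Q \<inter> LPM"
      by (rule image)
  qed
qed

section \<open>Conclusion\<close>

lemma bi_lipschitz_of_isometry:
  fixes T :: "(('a::metric_space \<times> 'a) \<Rightarrow>\<^sub>C real) \<Rightarrow> (('b::metric_space \<times> 'b) \<Rightarrow>\<^sub>C real)"
  assumes T: "isometry_onto T LPM LPM" and TP: "T ` (P \<inter> LPM) = Q \<inter> LPM"
    and P: "peak_class P" and Q: "peak_class Q"
    and bdd: "bounded (UNIV :: 'a set)" "bounded (UNIV :: 'b set)"
    and nondeg: "\<exists>u v :: 'b. u \<noteq> v"
  obtains \<phi> where "bi_lipschitz \<phi>" "\<And>d u v. d \<in> LPM \<Longrightarrow> T d (u, v) = d (\<phi> u, \<phi> v)"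
proof -
  define T' where "T' = inv_into LPM T"
  have T': "isometry_onto T' LPM LPM"
    unfolding T'_def using T by (rule isometry_onto_inv_into)
  have T'T: "T' (T d) = d" if "d \<in> LPM" for d
    unfolding T'_def using T that by (rule isometry_onto_inv_into_left)
  have "T' ` T ` (P \<inter> LPM) = P \<inter> LPM"
    using T'T by (force simp: image_image)
  then have T'P: "T' ` (Q \<inter> LPM) = P \<inter> LPM"
    by (simp only: TP)
  have ex_b: "\<exists>u v. u \<noteq> v \<and> (\<forall>d\<in>LPM. T d (u, v) = d (z, w))" if "z \<noteq> w" for z w
    using isometry_pair_eq[OF T TP P Q bdd that] by metis
  \<comment> \<open>The correspondence for the inverse isometry, read back through
    \<open>T\<close>.\<close>
  have ex_a: "\<exists>z w. z \<noteq> w \<and> (\<forall>d\<in>LPM. T d (u, v) = d (z, w))" if uv: "u \<noteq> v" for u v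
  proof -
    obtain z w where "z \<noteq> w" "\<And>e. e \<in> LPM \<Longrightarrow> T' e (z, w) = e (u, v)"
      using isometry_pair_eq[OF T' T'P Q P bdd(2,1) uv] by metis
    then show ?thesis
      using T'T isometry_onto_mem[OF T] by metis
  qed
  have TL: "T ` LPM = LPM"
    using T by (simp add: isometry_onto_def)
  obtain \<phi> where \<phi>: "bij \<phi>" "\<And>d u v. d \<in> LPM \<Longrightarrow> T d (u, v) = d (\<phi> u, \<phi> v)"
    using isometry_point_map[OF TL bdd nondeg ex_a ex_b] by metis
  have "bi_lipschitz \<phi>"
    by (rule bi_lipschitz_of_LPM_pullback[OF TL bdd \<phi>])
  then show ?thesis
    using that \<phi>(2) by blast
qed

text \<open>Both maps send doubletons to the same doubletons, so \<open>\<psi> u\<close> lies in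
  \<open>{\<phi> u, \<phi> v}\<close> and in \<open>{\<phi> u, \<phi> w}\<close>, which meet only in
  \<open>\<phi> u\<close>.\<close>

lemma point_map_unique:
  fixes \<phi> \<psi> :: "'b \<Rightarrow> 'a::metric_space"
  assumes bdd: "bounded (UNIV :: 'a set)" and "inj \<phi>"
    and eq: "\<And>d u v. d \<in> LPM \<Longrightarrow> d (\<phi> u, \<phi> v) = d (\<psi> u, \<psi> v)"
    and three: "\<And>u v :: 'b. \<exists>w. w \<noteq> u \<and> w \<noteq> v"
  shows "\<psi> = \<phi>"
proof
  fix u
  have pair: "\<psi> u = \<phi> u \<or> \<psi> u = \<phi> v" if "v \<noteq> u" for v
  proof -
    have "\<phi> u \<noteq> \<phi> v"
      using that \<open>inj \<phi>\<close> by (metis injD)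
    then have "{\<psi> u, \<psi> v} = {\<phi> u, \<phi> v}"
      by (rule doubleton_eq_of_LPM_le[OF bdd]) (simp add: eq)
    then show ?thesis
      by (auto simp: doubleton_eq_iff)
  qed
  obtain v where v: "v \<noteq> u"
    using three by metis
  obtain w where w: "w \<noteq> u" "w \<noteq> v"
    using three by metis
  show "\<psi> u = \<phi> u"
    using pair[OF v] pair[OF w(1)] w(2) \<open>inj \<phi>\<close> by (metis injD)
qed

text \<open>Infinite types are covered as well, since their \<open>card\<close> is 0.\<close>

lemma ex_third_point:
  assumes "\<exists>x y :: 'b. x \<noteq> y" "card (UNIV :: 'b set) \<noteq> 2"
  shows "\<exists>w :: 'b. w \<noteq> u \<and> w \<noteq> v"
proof (rule ccontr)
  assume "\<not> ?thesis"
  then have UNIV: "UNIV = {u, v}"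
    by auto
  then have "u \<noteq> v"
    using assms(1) by (metis UNIV_I empty_iff insert_iff)
  then have "card (UNIV :: 'b set) = 2"
    unfolding UNIV by simp
  then show False
    using assms(2) by simp
qed

theorem theoremB:
  fixes PX :: "(('a::metric_space \<times> 'a) \<Rightarrow>\<^sub>C real) set"
    and PY :: "(('b::metric_space \<times> 'b) \<Rightarrow>\<^sub>C real) set"
  assumes "\<exists>x y :: 'a. x \<noteq> y" and "bounded (UNIV :: 'a set)"
    and "\<exists>x y :: 'b. x \<noteq> y" and "bounded (UNIV :: 'b set)"
    and "(PX = Pc \<and> PY = Pc) \<or> (PX = Pp \<and> PY = Pp)"
  shows "((\<exists>\<phi> :: 'b \<Rightarrow> 'a. bi_lipschitz \<phi>) \<longleftrightarrow>
           (\<exists>T. isometry_onto T LPM LPM \<and> T ` (PX \<inter> LPM) = PY \<inter> LPM)) \<and>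
         (\<forall>T. isometry_onto T LPM LPM \<and> T ` (PX \<inter> LPM) = PY \<inter> LPM \<longrightarrow>
           (\<exists>\<phi> :: 'b \<Rightarrow> 'a. bi_lipschitz \<phi> \<and>
              (\<forall>d\<in>LPM. \<forall>x y. apply_bcontfun (T d) (x, y) = apply_bcontfun d (\<phi> x, \<phi> y))) \<and>
           (card (UNIV :: 'a set) \<noteq> 2 \<and> card (UNIV :: 'b set) \<noteq> 2 \<longrightarrow>
              (\<exists>!\<phi> :: 'b \<Rightarrow> 'a. bi_lipschitz \<phi> \<and>
                 (\<forall>d\<in>LPM. \<forall>x y. apply_bcontfun (T d) (x, y) = apply_bcontfun d (\<phi> x, \<phi> y)))))"
proof -
  let ?induces = "\<lambda>T \<phi>. bi_lipschitz \<phi> \<and>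
    (\<forall>d\<in>LPM. \<forall>x y. apply_bcontfun (T d) (x, y) = apply_bcontfun d (\<phi> x, \<phi> y))"
  have peak: "peak_class PX" "peak_class PY"
    using assms(5) peak_class_Pc peak_class_Pp by auto
  have ex: "\<exists>\<phi>. ?induces T \<phi>" if "isometry_onto T LPM LPM" "T ` (PX \<inter> LPM) = PY \<inter> LPM" for T
    using bi_lipschitz_of_isometry[OF that peak assms(2,4,3)] by metis
  have unique: "\<exists>!\<phi>. ?induces T \<phi>"
    if T: "isometry_onto T LPM LPM" "T ` (PX \<inter> LPM) = PY \<inter> LPM" and card: "card (UNIV :: 'b set) \<noteq> 2" for T
  proof -
    obtain \<phi> where \<phi>: "?induces T \<phi>"
      using ex[OF T] by (rule exE)
    show ?thesis
    proof (rule ex1I)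
      show "?induces T \<phi>"
        by (rule \<phi>)
      fix \<psi> assume \<psi>: "?induces T \<psi>"
      have "inj \<phi>"
        using \<phi> by (simp add: bi_lipschitz_def bij_is_inj)
      then show "\<psi> = \<phi>"
        using \<phi> \<psi> ex_third_point[OF assms(3) card] by (intro point_map_unique[OF assms(2)]) simp_all
    qed
  qed
  have "\<exists>T. isometry_onto T LPM LPM \<and> T ` (PX \<inter> LPM) = PY \<inter> LPM" if "bi_lipschitz \<phi>" for \<phi> :: "'b \<Rightarrow> 'a"
    using isometry_of_bi_lipschitz[OF that assms(5)] by metis
  with ex unique show ?thesis
    by metis
qed

end
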